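(* Consider a causal operational theory, let $\mathbb P=\{p_i=(|s_i),(e_i|)\}_{i=1}^n$ be an $n$-path experiment, and let $T$ be a phase transformation relative to $\mathbb P$. If $T$ is $n$-detectable and $(n-1)$-undetectable, then there is $n$th-order interference in this $n$-path experiment, i.e. there exist a state $|s)$ and an effect $(e|$ such that, for every choice of effects $(e_I|\in\mathcal E_I$ (one for each $I\subset\mathbb P$ occurring in the sum), $$\mathcal C_{s,e}\neq\sum_{I\subset\mathbb P}(-1)^{\,n-|I|+1}\,\mathcal C_{s,e_I}$$ as functions on the phase group $\mathcal P$, where the sum is over nonempty proper subsets $I$ of $\mathbb P$.
   Context: **Operational theories.** An operational theory has system types (with composites and a trivial system) and physical processes with input systems, output systems and a classical pointer with finitely many positions (outcomes). Processes compose sequentially (matching types) and in parallel, obeying the usual circuit laws. Every closed circuit with specified outcomes is assigned a probability, and outcomes are identified if they give the same probabilities in all closed circuits; the resulting classes are states $|s)$ (no inputs), effects $(e|$ (no outputs), and transformations (in general). For a fixed system, $\Omega$ is the set of states, $\mathcal E$ the set of effects (distinct effects are distinguished by their probabilities on states), and $\mathcal R$ the group of reversible transformations from the system to itself. $(e|T|s)\in[0,1]$ is a probability. A measurement is the collection $\{(e_r|\}_r$ of effects of one process with no outputs. The theory is causal: there is a unique deterministic effect $(u|$ with $\sum_r(e_r|=(u|$ for every measurement. **Paths.** A path is a pair $p=(|s),(e|)$ of a state and an effect with $(e|s)=1$. Paths $p_1,p_2$ are disjoint, $p_1\perp p_2$, if $(e_i|s_j)=\delta_{ij}$. An $n$-path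 experiment is a set $\mathbb P=\{p_i\}_{i=1}^n$ of $n$ mutually disjoint paths with $\sum_i(e_i|=(u|$. **Support.** Relative to $\mathbb P$: $\mathrm{Supp}[|s)]=\{p_i\in\mathbb P:(e_i|s)\neq0\}$ and $\mathrm{Supp}[(e|]=\{p_i\in\mathbb P:(e|s_i)\neq0\}$. For $I\subseteq\mathbb P$, $\mathcal E_I=\{(e|\in\mathcal E:\mathrm{Supp}[(e|]=I\}$ (subnormalised effects are included). **Phase group.** $\mathcal P=\{T\in\mathcal R:(e_i|T=(e_i|\ \text{for all } i\}$; its elements are phase transformations relative to $\mathbb P$. **Interference pattern.** For a state $|s)$ and effect $(e|$, $\mathcal C_{s,e}:\mathcal P\to[0,1]$, $\mathcal C_{s,e}(T)=(e|T|s)$. **Detectability.** A transformation $T$ is $m$-undetectable if $(e|T=(e|$ for all $(e|\in\bigcup_{I:|I|\le m}\mathcal E_I$. It is $m$-detectable if there exists $(e|\in\bigcup_{I:|I|\le m}\mathcal E_I$ with $(e|T\neq(e|$. *)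

theory Defs
  imports Complex_Main "HOL-Library.FuncSet"
begin

text \<open>
  A circuit with specified outcomes is called an event here. A process from \<open>A\<close> to \<open>B\<close> is
  represented by the list of its events, the \<open>r\<close>-th entry belonging to position \<open>r\<close> of the
  classical pointer. The pointer of a composite process is the lexicographically ordered
  product of the two pointers. \<open>seq \<Theta> g f\<close> is \<open>g\<close> after \<open>f\<close>.
\<close>

record ('s, 'f) optheory =
  tensor :: "'s \<Rightarrow> 's \<Rightarrow> 's"
  triv :: 's
  processes :: "'s \<Rightarrow> 's \<Rightarrow> 'f list set"
  seq :: "'f \<Rightarrow> 'f \<Rightarrow> 'f"
  par :: "'f \<Rightarrow> 'f \<Rightarrow> 'f"
  wire :: "'s \<Rightarrow> 'f"
  cross :: "'s \<Rightarrow> 's \<Rightarrow> 'f"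
  prob :: "'f \<Rightarrow> real"

definition events :: "('s, 'f) optheory \<Rightarrow> 's \<Rightarrow> 's \<Rightarrow> 'f set" where
  "events \<Theta> A B = (\<Union>fs\<in>processes \<Theta> A B. set fs)"

text \<open>
  Processes are not yet identified up to equal probabilities; the laws below are those that
  hold for circuit diagrams (a strict symmetric monoidal category).
\<close>

locale operational_theory =
  fixes \<Theta> :: "('s, 'f) optheory"
  assumes tensor_assoc: "tensor \<Theta> (tensor \<Theta> A B) C = tensor \<Theta> A (tensor \<Theta> B C)"
    and tensor_triv_left: "tensor \<Theta> (triv \<Theta>) A = A"
    and tensor_triv_right: "tensor \<Theta> A (triv \<Theta>) = A"
    and process_nonempty: "fs \<in> processes \<Theta> A B \<Longrightarrow> fs \<noteq> []"
    and wire_process: "[wire \<Theta> A] \<in> processes \<Theta> A A"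
    and cross_process: "[cross \<Theta> A B] \<in> processes \<Theta> (tensor \<Theta> A B) (tensor \<Theta> B A)"
    and seq_process: "\<lbrakk>fs \<in> processes \<Theta> A B; gs \<in> processes \<Theta> B C\<rbrakk>
          \<Longrightarrow> [seq \<Theta> g f. f \<leftarrow> fs, g \<leftarrow> gs] \<in> processes \<Theta> A C"
    and par_process: "\<lbrakk>fs \<in> processes \<Theta> A B; gs \<in> processes \<Theta> C D\<rbrakk>
          \<Longrightarrow> [par \<Theta> f g. f \<leftarrow> fs, g \<leftarrow> gs] \<in> processes \<Theta> (tensor \<Theta> A C) (tensor \<Theta> B D)"
    and seq_assoc: "\<lbrakk>f \<in> events \<Theta> A B; g \<in> events \<Theta> B C; h \<in> events \<Theta> C D\<rbrakk>
          \<Longrightarrow> seq \<Theta> h (seq \<Theta> g f) = seq \<Theta> (seq \<Theta> h g) f"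
    and seq_wire_left: "f \<in> events \<Theta> A B \<Longrightarrow> seq \<Theta> (wire \<Theta> B) f = f"
    and seq_wire_right: "f \<in> events \<Theta> A B \<Longrightarrow> seq \<Theta> f (wire \<Theta> A) = f"
    and par_assoc: "\<lbrakk>f \<in> events \<Theta> A B; g \<in> events \<Theta> C D; h \<in> events \<Theta> E F\<rbrakk>
          \<Longrightarrow> par \<Theta> (par \<Theta> f g) h = par \<Theta> f (par \<Theta> g h)"
    and par_triv_left: "f \<in> events \<Theta> A B \<Longrightarrow> par \<Theta> (wire \<Theta> (triv \<Theta>)) f = f"
    and par_triv_right: "f \<in> events \<Theta> A B \<Longrightarrow> par \<Theta> f (wire \<Theta> (triv \<Theta>)) = f"
    and par_wire: "par \<Theta> (wire \<Theta> A) (wire \<Theta> B) = wire \<Theta> (tensor \<Theta> A B)"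
    and interchange: "\<lbrakk>f \<in> events \<Theta> A B; g \<in> events \<Theta> B C; f' \<in> events \<Theta> A' B'; g' \<in> events \<Theta> B' C'\<rbrakk>
          \<Longrightarrow> par \<Theta> (seq \<Theta> g f) (seq \<Theta> g' f') = seq \<Theta> (par \<Theta> g g') (par \<Theta> f f')"
    and cross_natural: "\<lbrakk>f \<in> events \<Theta> A B; g \<in> events \<Theta> C D\<rbrakk>
          \<Longrightarrow> seq \<Theta> (cross \<Theta> B D) (par \<Theta> f g) = seq \<Theta> (par \<Theta> g f) (cross \<Theta> A C)"
    and cross_cross: "seq \<Theta> (cross \<Theta> B A) (cross \<Theta> A B) = wire \<Theta> (tensor \<Theta> A B)"
    and cross_tensor: "cross \<Theta> (tensor \<Theta> A B) C
          = seq \<Theta> (par \<Theta> (cross \<Theta> A C) (wire \<Theta> B)) (par \<Theta> (wire \<Theta> A) (cross \<Theta> B C))"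
    and prob_nonneg: "c \<in> events \<Theta> (triv \<Theta>) (triv \<Theta>) \<Longrightarrow> 0 \<le> prob \<Theta> c"
    and prob_sum: "cs \<in> processes \<Theta> (triv \<Theta>) (triv \<Theta>) \<Longrightarrow> (\<Sum>c\<leftarrow>cs. prob \<Theta> c) = 1"

text \<open>
  \<open>circuit_context \<Theta> A B C D K\<close>: \<open>K\<close> is a circuit from \<open>C\<close> to \<open>D\<close> (with specified outcomes)
  having one empty slot, into which an event from \<open>A\<close> to \<open>B\<close> can be inserted.
\<close>

inductive circuit_context ::
    "('s, 'f) optheory \<Rightarrow> 's \<Rightarrow> 's \<Rightarrow> 's \<Rightarrow> 's \<Rightarrow> ('f \<Rightarrow> 'f) \<Rightarrow> bool"
  for \<Theta> :: "('s, 'f) optheory" and A B :: 's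
where
  slot: "circuit_context \<Theta> A B A B (\<lambda>f. f)"
| seq_after: "\<lbrakk>circuit_context \<Theta> A B C D K; g \<in> events \<Theta> D E\<rbrakk>
    \<Longrightarrow> circuit_context \<Theta> A B C E (\<lambda>f. seq \<Theta> g (K f))"
| seq_before: "\<lbrakk>circuit_context \<Theta> A B C D K; g \<in> events \<Theta> E C\<rbrakk>
    \<Longrightarrow> circuit_context \<Theta> A B E D (\<lambda>f. seq \<Theta> (K f) g)"
| par_right: "\<lbrakk>circuit_context \<Theta> A B C D K; g \<in> events \<Theta> E F\<rbrakk>
    \<Longrightarrow> circuit_context \<Theta> A B (tensor \<Theta> C E) (tensor \<Theta> D F) (\<lambda>f. par \<Theta> (K f) g)"
| par_left: "\<lbrakk>circuit_context \<Theta> A B C D K; g \<in> events \<Theta> E F\<rbrakk>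
    \<Longrightarrow> circuit_context \<Theta> A B (tensor \<Theta> E C) (tensor \<Theta> F D) (\<lambda>f. par \<Theta> g (K f))"

definition indist :: "('s, 'f) optheory \<Rightarrow> 's \<Rightarrow> 's \<Rightarrow> ('f \<times> 'f) set" where
  "indist \<Theta> A B = {(f, g). f \<in> events \<Theta> A B \<and> g \<in> events \<Theta> A B \<and>
     (\<forall>K. circuit_context \<Theta> A B (triv \<Theta>) (triv \<Theta>) K \<longrightarrow> prob \<Theta> (K f) = prob \<Theta> (K g))}"

definition transformations :: "('s, 'f) optheory \<Rightarrow> 's \<Rightarrow> 's \<Rightarrow> 'f set set" where
  "transformations \<Theta> A B = events \<Theta> A B // indist \<Theta> A B"

definition states :: "('s, 'f) optheory \<Rightarrow> 's \<Rightarrow> 'f set set" where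
  "states \<Theta> A = transformations \<Theta> (triv \<Theta>) A"

definition effects :: "('s, 'f) optheory \<Rightarrow> 's \<Rightarrow> 'f set set" where
  "effects \<Theta> A = transformations \<Theta> A (triv \<Theta>)"

text \<open>\<open>class_comp \<Theta> A C G F\<close> is the class, from \<open>A\<close> to \<open>C\<close>, of the composite \<open>G\<close> after \<open>F\<close>.\<close>

definition class_comp :: "('s, 'f) optheory \<Rightarrow> 's \<Rightarrow> 's \<Rightarrow> 'f set \<Rightarrow> 'f set \<Rightarrow> 'f set" where
  "class_comp \<Theta> A C G F = indist \<Theta> A C `` {seq \<Theta> g f | g f. g \<in> G \<and> f \<in> F}"

definition identity :: "('s, 'f) optheory \<Rightarrow> 's \<Rightarrow> 'f set" where
  "identity \<Theta> A = indist \<Theta> A A `` {wire \<Theta> A}"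

text \<open>\<open>apply_effect \<Theta> e s\<close> is \<open>(e|s)\<close>, and \<open>after_effect \<Theta> A e T\<close> is the effect \<open>(e|T\<close>.
  All events in a class of closed circuits have the same probability, so the image is a singleton.\<close>

definition apply_effect :: "('s, 'f) optheory \<Rightarrow> 'f set \<Rightarrow> 'f set \<Rightarrow> real" where
  "apply_effect \<Theta> e s = the_elem (prob \<Theta> ` class_comp \<Theta> (triv \<Theta>) (triv \<Theta>) e s)"

definition after_effect :: "('s, 'f) optheory \<Rightarrow> 's \<Rightarrow> 'f set \<Rightarrow> 'f set \<Rightarrow> 'f set" where
  "after_effect \<Theta> A e T = class_comp \<Theta> A (triv \<Theta>) e T"

definition reversibles :: "('s, 'f) optheory \<Rightarrow> 's \<Rightarrow> 'f set set" where
  "reversibles \<Theta> A = {T \<in> transformations \<Theta> A A. \<exists>T' \<in> transformations \<Theta> A A.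
     class_comp \<Theta> A A T T' = identity \<Theta> A \<and> class_comp \<Theta> A A T' T = identity \<Theta> A}"

definition measurements :: "('s, 'f) optheory \<Rightarrow> 's \<Rightarrow> 'f set list set" where
  "measurements \<Theta> A = map (\<lambda>e. indist \<Theta> A (triv \<Theta>) `` {e}) ` processes \<Theta> A (triv \<Theta>)"

definition deterministic_effect :: "('s, 'f) optheory \<Rightarrow> 's \<Rightarrow> 'f set \<Rightarrow> bool" where
  "deterministic_effect \<Theta> A u \<longleftrightarrow> [u] \<in> measurements \<Theta> A"

definition unit_effect :: "('s, 'f) optheory \<Rightarrow> 's \<Rightarrow> 'f set" where
  "unit_effect \<Theta> A = (THE u. deterministic_effect \<Theta> A u)"

text \<open>Sums of effects are taken as functions on states, by which effects are distinguished.\<close>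

definition causal :: "('s, 'f) optheory \<Rightarrow> bool" where
  "causal \<Theta> \<longleftrightarrow> (\<forall>A. (\<exists>!u. deterministic_effect \<Theta> A u) \<and>
     (\<forall>es \<in> measurements \<Theta> A. \<forall>s \<in> states \<Theta> A.
        (\<Sum>e\<leftarrow>es. apply_effect \<Theta> e s) = apply_effect \<Theta> (unit_effect \<Theta> A) s))"

type_synonym 'f path = "'f set \<times> 'f set"

definition is_path :: "('s, 'f) optheory \<Rightarrow> 's \<Rightarrow> 'f path \<Rightarrow> bool" where
  "is_path \<Theta> A p \<longleftrightarrow> fst p \<in> states \<Theta> A \<and> snd p \<in> effects \<Theta> A \<and>
     apply_effect \<Theta> (snd p) (fst p) = 1"

definition disjoint_paths :: "('s, 'f) optheory \<Rightarrow> 'f path \<Rightarrow> 'f path \<Rightarrow> bool" where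
  "disjoint_paths \<Theta> p q \<longleftrightarrow>
     apply_effect \<Theta> (snd p) (fst p) = 1 \<and> apply_effect \<Theta> (snd p) (fst q) = 0 \<and>
     apply_effect \<Theta> (snd q) (fst p) = 0 \<and> apply_effect \<Theta> (snd q) (fst q) = 1"

definition path_experiment :: "('s, 'f) optheory \<Rightarrow> 's \<Rightarrow> nat \<Rightarrow> 'f path set \<Rightarrow> bool" where
  "path_experiment \<Theta> A n P \<longleftrightarrow> finite P \<and> card P = n \<and> (\<forall>p\<in>P. is_path \<Theta> A p) \<and>
     pairwise (disjoint_paths \<Theta>) P \<and>
     (\<forall>s \<in> states \<Theta> A. (\<Sum>p\<in>P. apply_effect \<Theta> (snd p) s) = apply_effect \<Theta> (unit_effect \<Theta> A) s)"

definition effect_support :: "('s, 'f) optheory \<Rightarrow> 'f path set \<Rightarrow> 'f set \<Rightarrow> 'f path set" where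
  "effect_support \<Theta> P e = {p \<in> P. apply_effect \<Theta> e (fst p) \<noteq> 0}"

definition effects_on ::
    "('s, 'f) optheory \<Rightarrow> 's \<Rightarrow> 'f path set \<Rightarrow> 'f path set \<Rightarrow> 'f set set" where
  "effects_on \<Theta> A P I = {e \<in> effects \<Theta> A. effect_support \<Theta> P e = I}"

definition phase_group :: "('s, 'f) optheory \<Rightarrow> 's \<Rightarrow> 'f path set \<Rightarrow> 'f set set" where
  "phase_group \<Theta> A P = {T \<in> reversibles \<Theta> A. \<forall>p\<in>P. after_effect \<Theta> A (snd p) T = snd p}"

definition interference_pattern ::
    "('s, 'f) optheory \<Rightarrow> 's \<Rightarrow> 'f path set \<Rightarrow> 'f set \<Rightarrow> 'f set \<Rightarrow> 'f set \<Rightarrow> real" where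
  "interference_pattern \<Theta> A P s e =
     (\<lambda>T \<in> phase_group \<Theta> A P. apply_effect \<Theta> (after_effect \<Theta> A e T) s)"

definition undetectable ::
    "('s, 'f) optheory \<Rightarrow> 's \<Rightarrow> 'f path set \<Rightarrow> nat \<Rightarrow> 'f set \<Rightarrow> bool" where
  "undetectable \<Theta> A P m T \<longleftrightarrow>
     (\<forall>e \<in> (\<Union>I \<in> {I. I \<subseteq> P \<and> card I \<le> m}. effects_on \<Theta> A P I). after_effect \<Theta> A e T = e)"

definition detectable ::
    "('s, 'f) optheory \<Rightarrow> 's \<Rightarrow> 'f path set \<Rightarrow> nat \<Rightarrow> 'f set \<Rightarrow> bool" where
  "detectable \<Theta> A P m T \<longleftrightarrow>
     (\<exists>e \<in> (\<Union>I \<in> {I. I \<subseteq> P \<and> card I \<le> m}. effects_on \<Theta> A P I). after_effect \<Theta> A e T \<noteq> e)"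

end

theory Submission imports Defs begin

text \<open>
  Every closed circuit around an effect is the effect applied to some state, because the rest of
  the circuit can be bent into a preparation. Hence an effect \<open>e\<close> that detects the phase
  transformation \<open>T\<close> satisfies \<open>(e|T|s) \<noteq> (e|s)\<close> for some state \<open>s\<close>. Effects supported on
  fewer than \<open>n\<close> paths do not see \<open>T\<close>, so any combination of their interference patterns takes
  the same value at \<open>T\<close> and at the identity, whereas the pattern of \<open>s\<close> and \<open>e\<close> does not.
\<close>

context operational_theory
begin

section \<open>Circuit identities for events and bending a closed circuit into a preparation\<close>

lemma wire_event: "wire \<Theta> A \<in> events \<Theta> A A"
  using wire_process unfolding events_def by force

lemma cross_event: "cross \<Theta> A B \<in> events \<Theta> (tensor \<Theta> A B) (tensor \<Theta> B A)"
  using cross_process unfolding events_def by force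

lemma seq_event:
  assumes "f \<in> events \<Theta> A B" "g \<in> events \<Theta> B C"
  shows "seq \<Theta> g f \<in> events \<Theta> A C"
proof -
  obtain fs gs where "fs \<in> processes \<Theta> A B" "f \<in> set fs" "gs \<in> processes \<Theta> B C" "g \<in> set gs"
    using assms unfolding events_def by auto
  then show ?thesis
    using seq_process[of fs A B gs C] unfolding events_def by (force intro!: bexI)
qed

lemma par_event:
  assumes "f \<in> events \<Theta> A B" "g \<in> events \<Theta> C D"
  shows "par \<Theta> f g \<in> events \<Theta> (tensor \<Theta> A C) (tensor \<Theta> B D)"
proof -
  obtain fs gs where "fs \<in> processes \<Theta> A B" "f \<in> set fs" "gs \<in> processes \<Theta> C D" "g \<in> set gs"
    using assms unfolding events_def by auto
  then show ?thesis
    using par_process[of fs A B gs C D] unfolding events_def by (force intro!: bexI)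
qed

text \<open>Naturality of \<open>cross\<close> carries one swap past the parallel composite, where
  it cancels against the other. This lets a slot standing on the right of another event be moved to
  the left.\<close>

lemma par_commute:
  assumes "f \<in> events \<Theta> A B" "g \<in> events \<Theta> C D"
  shows "par \<Theta> g f = seq \<Theta> (cross \<Theta> B D) (seq \<Theta> (par \<Theta> f g) (cross \<Theta> C A))"
proof -
  have "seq \<Theta> (cross \<Theta> B D) (seq \<Theta> (par \<Theta> f g) (cross \<Theta> C A))
      = seq \<Theta> (seq \<Theta> (cross \<Theta> B D) (par \<Theta> f g)) (cross \<Theta> C A)"
    by (rule seq_assoc[OF cross_event par_event[OF assms] cross_event])
  also have "\<dots> = seq \<Theta> (par \<Theta> g f) (seq \<Theta> (cross \<Theta> A C) (cross \<Theta> C A))"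
    by (simp only: cross_natural[OF assms]
        seq_assoc[OF cross_event cross_event par_event[OF assms(2,1)], symmetric])
  also have "\<dots> = par \<Theta> g f"
    by (simp add: cross_cross seq_wire_right[OF par_event[OF assms(2,1)]])
  finally show ?thesis ..
qed

text \<open>Since \<open>f\<close> has no output, whatever follows it or runs beside it can be
  performed earlier, so \<open>f\<close> can be postponed to the very end; \<open>g\<close> collects
  the rest of the circuit. Arbitrary \<open>C\<close> and \<open>D\<close> are needed because a
  closed context is built up from contexts that need not be closed.\<close>

lemma effect_context_normal_form:
  assumes "circuit_context \<Theta> A (triv \<Theta>) C D K"
  shows "\<exists>g \<in> events \<Theta> C (tensor \<Theta> A D).
    \<forall>f \<in> events \<Theta> A (triv \<Theta>). K f = seq \<Theta> (par \<Theta> f (wire \<Theta> D)) g"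
  using assms
proof induction
  case slot
  show ?case
    by (rule bexI[of _ "wire \<Theta> A"])
      (auto simp: tensor_triv_right par_triv_right seq_wire_right wire_event)
next
  case (seq_after C D K k E)
  then obtain g where g: "g \<in> events \<Theta> C (tensor \<Theta> A D)"
    and K: "\<And>f. f \<in> events \<Theta> A (triv \<Theta>) \<Longrightarrow> K f = seq \<Theta> (par \<Theta> f (wire \<Theta> D)) g" by blast
  note k = seq_after.hyps(2)
  let ?k = "par \<Theta> (wire \<Theta> A) k"
  have k': "?k \<in> events \<Theta> (tensor \<Theta> A D) (tensor \<Theta> A E)"
    by (rule par_event[OF wire_event k])
  show ?case
  proof (intro bexI[of _ "seq \<Theta> ?k g"] ballI seq_event[OF g k'])
    fix f assume f: "f \<in> events \<Theta> A (triv \<Theta>)"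
    have fD: "par \<Theta> f (wire \<Theta> D) \<in> events \<Theta> (tensor \<Theta> A D) D"
      and fE: "par \<Theta> f (wire \<Theta> E) \<in> events \<Theta> (tensor \<Theta> A E) E"
      using par_event[OF f wire_event] by (simp_all add: tensor_triv_left)
    \<comment> \<open>Both sides equal \<open>par \<Theta> f k\<close>: the two events act on
      different factors, so \<open>interchange\<close> allows either order.\<close>
    have slide: "seq \<Theta> k (par \<Theta> f (wire \<Theta> D)) = seq \<Theta> (par \<Theta> f (wire \<Theta> E)) ?k"
      using interchange[OF f wire_event wire_event k] interchange[OF wire_event f k wire_event]
      by (simp add: seq_wire_left[OF f] seq_wire_right[OF f] seq_wire_left[OF k]
          seq_wire_right[OF k] par_triv_left[OF k])
    have "seq \<Theta> k (K f) = seq \<Theta> (seq \<Theta> k (par \<Theta> f (wire \<Theta> D))) g"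
      by (simp add: K[OF f] seq_assoc[OF g fD k])
    then show "seq \<Theta> k (K f) = seq \<Theta> (par \<Theta> f (wire \<Theta> E)) (seq \<Theta> ?k g)"
      by (simp add: slide seq_assoc[OF g k' fE])
  qed
next
  case (seq_before C D K k E)
  then obtain g where g: "g \<in> events \<Theta> C (tensor \<Theta> A D)"
    and K: "\<And>f. f \<in> events \<Theta> A (triv \<Theta>) \<Longrightarrow> K f = seq \<Theta> (par \<Theta> f (wire \<Theta> D)) g" by blast
  note k = seq_before.hyps(2)
  show ?case
    using seq_assoc[OF k g par_event[OF _ wire_event]] K
    by (intro bexI[of _ "seq \<Theta> g k"] ballI seq_event[OF k g]) simp
next
  case (par_right C D K k E F)
  then obtain g where g: "g \<in> events \<Theta> C (tensor \<Theta> A D)"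
    and K: "\<And>f. f \<in> events \<Theta> A (triv \<Theta>) \<Longrightarrow> K f = seq \<Theta> (par \<Theta> f (wire \<Theta> D)) g" by blast
  note k = par_right.hyps(2)
  show ?case
  \<comment> \<open>The event \<open>k\<close> is performed alongside \<open>g\<close>; its output
    \<open>F\<close> then waits next to \<open>D\<close> while \<open>f\<close> acts.\<close>
  proof (intro bexI[of _ "par \<Theta> g k"] ballI)
    fix f assume f: "f \<in> events \<Theta> A (triv \<Theta>)"
    show "par \<Theta> (K f) k = seq \<Theta> (par \<Theta> f (wire \<Theta> (tensor \<Theta> D F))) (par \<Theta> g k)"
      using interchange[OF g par_event[OF f wire_event] k wire_event]
      by (simp add: K[OF f] seq_wire_left[OF k] par_assoc[OF f wire_event wire_event] par_wire)
  qed (use par_event[OF g k] in \<open>simp add: tensor_assoc\<close>)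
next
  case (par_left C D K k E F)
  then obtain g where g: "g \<in> events \<Theta> C (tensor \<Theta> A D)"
    and K: "\<And>f. f \<in> events \<Theta> A (triv \<Theta>) \<Longrightarrow> K f = seq \<Theta> (par \<Theta> f (wire \<Theta> D)) g" by blast
  note k = par_left.hyps(2)
  \<comment> \<open>In \<open>?g\<close> the inputs are first swapped so that the slot stands on the
    left, as in the previous case. The outputs then come as \<open>D\<close>, \<open>F\<close>, and
    \<open>?c\<close> puts them into the required order \<open>F\<close>, \<open>D\<close> without
    touching \<open>A\<close>.\<close>
  let ?c = "par \<Theta> (wire \<Theta> A) (cross \<Theta> D F)"
  let ?g = "seq \<Theta> (par \<Theta> g k) (cross \<Theta> E C)"
  have c: "?c \<in> events \<Theta> (tensor \<Theta> A (tensor \<Theta> D F)) (tensor \<Theta> A (tensor \<Theta> F D))"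
    by (rule par_event[OF wire_event cross_event])
  have gk: "par \<Theta> g k \<in> events \<Theta> (tensor \<Theta> C E) (tensor \<Theta> A (tensor \<Theta> D F))"
    using par_event[OF g k] by (simp add: tensor_assoc)
  have g': "?g \<in> events \<Theta> (tensor \<Theta> E C) (tensor \<Theta> A (tensor \<Theta> D F))"
    by (rule seq_event[OF cross_event gk])
  show ?case
  proof (intro bexI[of _ "seq \<Theta> ?c ?g"] ballI seq_event[OF g' c])
    fix f assume f: "f \<in> events \<Theta> A (triv \<Theta>)"
    let ?f = "par \<Theta> f (wire \<Theta> (tensor \<Theta> D F))"
    let ?f' = "par \<Theta> f (wire \<Theta> (tensor \<Theta> F D))"
    have f1: "?f \<in> events \<Theta> (tensor \<Theta> A (tensor \<Theta> D F)) (tensor \<Theta> D F)"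
      and f2: "?f' \<in> events \<Theta> (tensor \<Theta> A (tensor \<Theta> F D)) (tensor \<Theta> F D)"
      using par_event[OF f wire_event] by (simp_all only: tensor_triv_left)
    have fD: "par \<Theta> f (wire \<Theta> D) \<in> events \<Theta> (tensor \<Theta> A D) D"
      using par_event[OF f wire_event] by (simp only: tensor_triv_left)
    have Kf: "K f \<in> events \<Theta> C D"
      using seq_event[OF g fD] by (simp add: K[OF f])
    \<comment> \<open>The sliding argument again, with \<open>cross \<Theta> D F\<close> in place of
      \<open>k\<close>: the final swap is moved in front of \<open>f\<close>, where it becomes
      \<open>?c\<close>.\<close>
    have slide: "seq \<Theta> (cross \<Theta> D F) ?f = seq \<Theta> ?f' ?c"
      using interchange[OF f wire_event wire_event cross_event, of D F]
        interchange[OF wire_event f cross_event wire_event, of F D]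
      by (simp add: seq_wire_left[OF wire_event] seq_wire_right[OF f] seq_wire_left[OF cross_event]
          seq_wire_left[OF f] seq_wire_right[OF cross_event] par_triv_left[OF cross_event])
    have "par \<Theta> (K f) k = seq \<Theta> ?f (par \<Theta> g k)"
      using interchange[OF g par_event[OF f wire_event] k wire_event]
      by (simp add: K[OF f] seq_wire_left[OF k] par_assoc[OF f wire_event wire_event] par_wire)
    then have "par \<Theta> k (K f) = seq \<Theta> (cross \<Theta> D F) (seq \<Theta> ?f ?g)"
      by (simp add: par_commute[OF Kf k] seq_assoc[OF cross_event gk f1])
    also have "\<dots> = seq \<Theta> ?f' (seq \<Theta> ?c ?g)"
      by (simp add: seq_assoc[OF g' f1 cross_event] slide seq_assoc[OF g' c f2])
    finally show "par \<Theta> k (K f) = seq \<Theta> ?f' (seq \<Theta> ?c ?g)" .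
  qed
qed

section \<open>Indistinguishability as a congruence, and calculation with classes\<close>

lemma circuit_context_comp:
  assumes "circuit_context \<Theta> A' B' C D K" "circuit_context \<Theta> A B A' B' L"
  shows "circuit_context \<Theta> A B C D (\<lambda>f. K (L f))"
  using assms by (induction rule: circuit_context.induct) (auto intro: circuit_context.intros)

text \<open>A closed context around \<open>L f\<close> is, after composition with \<open>L\<close>,
  a closed context around \<open>f\<close>.\<close>

lemma indist_context:
  assumes "(f, f') \<in> indist \<Theta> A B" "circuit_context \<Theta> A B C D L"
    and "L f \<in> events \<Theta> C D" "L f' \<in> events \<Theta> C D"
  shows "(L f, L f') \<in> indist \<Theta> C D"
  using assms circuit_context_comp[OF _ assms(2)] unfolding indist_def by auto

lemma equiv_indist: "equiv (events \<Theta> A B) (indist \<Theta> A B)"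
  by (rule equivI) (auto simp: indist_def refl_on_def sym_def trans_def)

lemma class_refl: "f \<in> events \<Theta> A B \<Longrightarrow> f \<in> indist \<Theta> A B `` {f}"
  by (rule equiv_class_self[OF equiv_indist])

text \<open>One factor is replaced at a time, the other serving as the context; transitivity joins
  the two replacements.\<close>

lemma indist_seq:
  assumes "(f, f') \<in> indist \<Theta> A B" "(g, g') \<in> indist \<Theta> B C"
  shows "(seq \<Theta> g f, seq \<Theta> g' f') \<in> indist \<Theta> A C"
proof -
  have ev: "f \<in> events \<Theta> A B" "f' \<in> events \<Theta> A B" "g \<in> events \<Theta> B C" "g' \<in> events \<Theta> B C"
    using assms by (auto simp: indist_def)
  have "(seq \<Theta> g f, seq \<Theta> g f') \<in> indist \<Theta> A C"
    by (rule indist_context[OF assms(1) seq_after[OF slot ev(3)]]) (auto intro: seq_event ev)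
  moreover have "(seq \<Theta> g f', seq \<Theta> g' f') \<in> indist \<Theta> A C"
    by (rule indist_context[OF assms(2) seq_before[OF slot ev(2)]]) (auto intro: seq_event ev)
  ultimately show ?thesis
    using equiv_indist by (meson equivE transE)
qed

text \<open>As \<open>indist\<close> respects \<open>seq\<close>, all composites of representatives
  lie in one class, so a single choice of representatives suffices for later calculations.\<close>

lemma class_comp_class:
  assumes f: "f \<in> events \<Theta> A B" and g: "g \<in> events \<Theta> B C"
  shows "class_comp \<Theta> A C (indist \<Theta> B C `` {g}) (indist \<Theta> A B `` {f})
    = indist \<Theta> A C `` {seq \<Theta> g f}"
proof
  show "class_comp \<Theta> A C (indist \<Theta> B C `` {g}) (indist \<Theta> A B `` {f})
      \<subseteq> indist \<Theta> A C `` {seq \<Theta> g f}"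
    using indist_seq equiv_indist[of A C] unfolding class_comp_def
    by (auto elim!: equivE) (meson transE)
  show "indist \<Theta> A C `` {seq \<Theta> g f}
      \<subseteq> class_comp \<Theta> A C (indist \<Theta> B C `` {g}) (indist \<Theta> A B `` {f})"
    using class_refl[OF f] class_refl[OF g] unfolding class_comp_def by blast
qed

text \<open>The bare slot is itself a closed context for closed circuits, so \<open>prob\<close> is
  constant on their classes and \<open>the_elem\<close> is applied to a singleton.\<close>

lemma apply_effect_class:
  assumes "s \<in> events \<Theta> (triv \<Theta>) A" "e \<in> events \<Theta> A (triv \<Theta>)"
  shows "apply_effect \<Theta> (indist \<Theta> A (triv \<Theta>) `` {e}) (indist \<Theta> (triv \<Theta>) A `` {s})
    = prob \<Theta> (seq \<Theta> e s)"
proof -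
  let ?c = "seq \<Theta> e s"
  have c: "?c \<in> events \<Theta> (triv \<Theta>) (triv \<Theta>)" by (rule seq_event[OF assms])
  have "prob \<Theta> d = prob \<Theta> ?c" if "d \<in> indist \<Theta> (triv \<Theta>) (triv \<Theta>) `` {?c}" for d
    using that circuit_context.slot[of \<Theta> "triv \<Theta>" "triv \<Theta>"] unfolding indist_def by auto
  then have "prob \<Theta> ` (indist \<Theta> (triv \<Theta>) (triv \<Theta>) `` {?c}) = {prob \<Theta> ?c}"
    using class_refl[OF c] by blast
  then show ?thesis
    by (simp add: apply_effect_def class_comp_class[OF assms])
qed

lemma transformationsE:
  assumes "F \<in> transformations \<Theta> A B"
  obtains f where "f \<in> events \<Theta> A B" "F = indist \<Theta> A B `` {f}"
  using assms unfolding transformations_def by (rule quotientE)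

lemma class_transformation:
  "f \<in> events \<Theta> A B \<Longrightarrow> indist \<Theta> A B `` {f} \<in> transformations \<Theta> A B"
  unfolding transformations_def by (rule quotientI)

text \<open>Although \<open>indist\<close> tests an effect in all closed contexts, the normal form
  reduces each test to one on a state.\<close>

lemma effect_eqI:
  assumes "d \<in> effects \<Theta> A" "e \<in> effects \<Theta> A"
    and eq: "\<And>s. s \<in> states \<Theta> A \<Longrightarrow> apply_effect \<Theta> d s = apply_effect \<Theta> e s"
  shows "d = e"
proof -
  obtain a b where a: "a \<in> events \<Theta> A (triv \<Theta>)" "d = indist \<Theta> A (triv \<Theta>) `` {a}"
    and b: "b \<in> events \<Theta> A (triv \<Theta>)" "e = indist \<Theta> A (triv \<Theta>) `` {b}"
    using assms(1,2) unfolding effects_def by (metis transformationsE)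
  have "prob \<Theta> (K a) = prob \<Theta> (K b)"
    if K: "circuit_context \<Theta> A (triv \<Theta>) (triv \<Theta>) (triv \<Theta>) K" for K
  proof -
    \<comment> \<open>With \<open>D\<close> trivial the idle wire disappears, and \<open>g\<close>
      is a preparation of \<open>A\<close>.\<close>
    obtain g where g: "g \<in> events \<Theta> (triv \<Theta>) A"
      and Kf: "\<And>f. f \<in> events \<Theta> A (triv \<Theta>) \<Longrightarrow> K f = seq \<Theta> f g"
      using effect_context_normal_form[OF K] by (auto simp: tensor_triv_right par_triv_right)
    have "indist \<Theta> (triv \<Theta>) A `` {g} \<in> states \<Theta> A"
      unfolding states_def by (rule class_transformation[OF g])
    from eq[OF this] show ?thesis
      by (simp add: a b Kf apply_effect_class g)
  qed
  then have "(a, b) \<in> indist \<Theta> A (triv \<Theta>)"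
    using a b by (simp add: indist_def)
  then show ?thesis
    using a b equiv_class_eq[OF equiv_indist] by metis
qed

section \<open>Transformations acting on effects, and interference\<close>

lemma after_effect_effects:
  assumes "e \<in> effects \<Theta> A" "T \<in> transformations \<Theta> A A"
  shows "after_effect \<Theta> A e T \<in> effects \<Theta> A"
  using assms unfolding effects_def after_effect_def
  by (auto elim!: transformationsE simp: class_comp_class intro!: class_transformation seq_event)

lemma after_effect_identity:
  assumes "e \<in> effects \<Theta> A"
  shows "after_effect \<Theta> A e (identity \<Theta> A) = e"
  using assms unfolding effects_def after_effect_def identity_def
  by (auto elim!: transformationsE simp: class_comp_class wire_event seq_wire_right)

lemma identity_reversible: "identity \<Theta> A \<in> reversibles \<Theta> A"
proof -
  have "identity \<Theta> A \<in> transformations \<Theta> A A"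
    unfolding identity_def by (rule class_transformation[OF wire_event])
  moreover have "class_comp \<Theta> A A (identity \<Theta> A) (identity \<Theta> A) = identity \<Theta> A"
    by (simp add: identity_def class_comp_class[OF wire_event wire_event] seq_wire_left[OF wire_event])
  ultimately show ?thesis unfolding reversibles_def by blast
qed

text \<open>This makes the identity available as the point of the phase group with which
  \<open>T\<close> is compared.\<close>

lemma identity_phase_group:
  assumes "path_experiment \<Theta> A n P"
  shows "identity \<Theta> A \<in> phase_group \<Theta> A P"
  using assms unfolding phase_group_def path_experiment_def is_path_def
  by (simp add: identity_reversible after_effect_identity)

end

theorem theorem1:
  fixes \<Theta> :: "('s, 'f) optheory" and A :: 's and n :: nat
    and P :: "'f path set" and T :: "'f set"
  assumes "operational_theory \<Theta>"
    and "causal \<Theta>"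
    and "path_experiment \<Theta> A n P"
    and "T \<in> phase_group \<Theta> A P"
    and "detectable \<Theta> A P n T"
    and "undetectable \<Theta> A P (n - 1) T"
  shows "\<exists>s \<in> states \<Theta> A. \<exists>e \<in> effects \<Theta> A. \<forall>\<epsilon> :: 'f path set \<Rightarrow> 'f set.
    (\<forall>I. I \<noteq> {} \<and> I \<subset> P \<longrightarrow> \<epsilon> I \<in> effects_on \<Theta> A P I) \<longrightarrow>
    interference_pattern \<Theta> A P s e \<noteq>
      (\<lambda>T' \<in> phase_group \<Theta> A P. \<Sum>I \<in> {I. I \<noteq> {} \<and> I \<subset> P}.
         (-1) ^ (n - card I + 1) * interference_pattern \<Theta> A P s (\<epsilon> I) T')"
proof -
  interpret operational_theory \<Theta> by fact
  let ?G = "phase_group \<Theta> A P"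
  have P: "finite P" "card P = n"
    using assms(3) by (simp_all add: path_experiment_def)
  have T: "T \<in> transformations \<Theta> A A"
    using assms(4) by (simp add: phase_group_def reversibles_def)
  have id: "identity \<Theta> A \<in> ?G"
    by (rule identity_phase_group[OF assms(3)])
  obtain e where e: "e \<in> effects \<Theta> A" and eT: "after_effect \<Theta> A e T \<noteq> e"
    using assms(5) unfolding detectable_def effects_on_def by auto
  \<comment> \<open>The contrapositive of \<open>effect_eqI\<close> supplies a state on which the
    detecting effect \<open>e\<close> changes under \<open>T\<close>.\<close>
  then obtain s where s: "s \<in> states \<Theta> A"
    and ne: "apply_effect \<Theta> (after_effect \<Theta> A e T) s \<noteq> apply_effect \<Theta> e s"
    using effect_eqI[OF after_effect_effects[OF e T] e] by blast
  show ?thesis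
  proof (intro bexI[OF _ s] bexI[OF _ e] allI impI)
    fix \<epsilon> :: "'f path set \<Rightarrow> 'f set"
    assume \<epsilon>: "\<forall>I. I \<noteq> {} \<and> I \<subset> P \<longrightarrow> \<epsilon> I \<in> effects_on \<Theta> A P I"
    let ?R = "\<lambda>T' \<in> ?G. \<Sum>I \<in> {I. I \<noteq> {} \<and> I \<subset> P}.
         (-1) ^ (n - card I + 1) * interference_pattern \<Theta> A P s (\<epsilon> I) T'"
    have "interference_pattern \<Theta> A P s (\<epsilon> I) T
        = interference_pattern \<Theta> A P s (\<epsilon> I) (identity \<Theta> A)" if I: "I \<noteq> {}" "I \<subset> P" for I
    proof -
      have "\<epsilon> I \<in> effects_on \<Theta> A P I" using \<epsilon> I by blast
      \<comment> \<open>A proper subset of the \<open>n\<close> paths has at most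
        \<open>n - 1\<close> elements, exactly the range in which \<open>T\<close> is
        undetectable.\<close>
      moreover have "I \<subseteq> P" "card I \<le> n - 1"
        using psubset_card_mono[OF P(1) I(2)] I(2) P(2) by auto
      ultimately have "after_effect \<Theta> A (\<epsilon> I) T = \<epsilon> I" "\<epsilon> I \<in> effects \<Theta> A"
        using assms(6) unfolding undetectable_def effects_on_def by blast+
      then show ?thesis
        using assms(4) id by (simp add: interference_pattern_def after_effect_identity)
    qed
    \<comment> \<open>The summands agree one by one, whatever their coefficients.\<close>
    then have "?R T = ?R (identity \<Theta> A)"
      using assms(4) id by (auto intro!: sum.cong)
    moreover have "interference_pattern \<Theta> A P s e T
        \<noteq> interference_pattern \<Theta> A P s e (identity \<Theta> A)"
      using assms(4) id ne by (simp add: interference_pattern_def after_effect_identity[OF e])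
    ultimately show "interference_pattern \<Theta> A P s e \<noteq> ?R" by metis
  qed
qed

end
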